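(* Let $d\ge1$, $b>0$, $T>0$, $m>C>1$ with $C$ an integer, let $\boldsymbol a_1,\dots,\boldsymbol a_C\in\mathbb{R}^d$, $\boldsymbol a=C^{-1}\sum_{c=1}^C \boldsymbol a_c$ and $\sigma_{\boldsymbol a}^2=C^{-1}\sum_{c=1}^C\|\boldsymbol a_c-\boldsymbol a\|^2$. Let $f_c$ be the density of $\mathcal N(\boldsymbol a_c,\,m^{-1}Cb\,I_d)$, $c=1,\dots,C$. For $i=1,2,\dots$ let $\vec X_{0,i}=(X_{0,i}^{(1)},\dots,X_{0,i}^{(C)})$ be i.i.d. with independent components $X_{0,i}^{(c)}\sim f_c$, and let $\mathrm{CESS}_0$ be the initial conditional effective sample size of the first $N$ particles (defined in the context). Then, as $N\to\infty$, $$N^{-1}\,\mathrm{CESS}_0\ \to\ \exp\left\{-\frac{\frac{\sigma_{\boldsymbol a}^2 b}{m}}{\left(\frac TC+\frac bm\right)\left(\frac TC+\frac{2b}{m}\right)}\right\}\cdot\left[1+\frac{\left(\frac{Cb}{Tm}\right)^2}{1+\frac{2Cb}{Tm}}\right]^{-\frac{(C-1)d}{2}}.$$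
   Context: The initial weight of particle $i$ is $$\rho_{0,i}=\exp\Big\{-\sum_{c=1}^C\frac{\|X_{0,i}^{(c)}-\bar X_{0,i}\|^2}{2T}\Big\},\qquad \bar X_{0,i}=C^{-1}\sum_{c=1}^C X_{0,i}^{(c)},$$ and the initial conditional effective sample size is $$\mathrm{CESS}_0=\frac{\big(\sum_{i=1}^N\rho_{0,i}\big)^2}{\sum_{i=1}^N\rho_{0,i}^2}.$$ *)

theory Defs
  imports "HOL-Probability.Probability"
begin

text \<open>Density of the normal distribution with mean \<open>a\<close> and covariance matrix \<open>v\<close> times the
  identity, on Euclidean space of dimension \<open>CARD('d)\<close>; \<open>v\<close> is the variance of a coordinate,
  not its standard deviation.\<close>

definition iso_normal_density :: "real ^ 'd \<Rightarrow> real \<Rightarrow> real ^ 'd \<Rightarrow> real" where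
  "iso_normal_density a v x =
     (2 * pi * v) powr (- real CARD('d) / 2) * exp (- (norm (x - a))\<^sup>2 / (2 * v))"

lemma iso_normal_density_eq_prod:
  fixes a x :: "real ^ 'd"
  assumes "v > 0"
  shows "iso_normal_density a v x = (\<Prod>j\<in>UNIV. normal_density (a $ j) (sqrt v) (x $ j))"
proof -
  have nrm: "(norm (x - a))\<^sup>2 = (\<Sum>j\<in>UNIV. (x $ j - a $ j)\<^sup>2)"
    by (simp add: norm_vec_def L2_set_def sum_nonneg)
  have c: "(1 / sqrt (2 * pi * v)) ^ CARD('d) = (2 * pi * v) powr (- real CARD('d) / 2)"
  proof -
    have r: "1 / sqrt (2 * pi * v) = (2 * pi * v) powr (- 1 / 2)"
      using assms by (simp add: powr_minus_divide powr_half_sqrt)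
    have "2 * pi * v \<noteq> 0"
      using assms by simp
    then show ?thesis
      unfolding r by (subst powr_power) simp_all
  qed
  show ?thesis
    unfolding iso_normal_density_def normal_density_def prod.distrib
    using assms
    by (simp add: nrm c exp_sum[symmetric] sum_divide_distrib sum_negf)
qed

definition vmean :: "nat \<Rightarrow> (nat \<Rightarrow> 'v::real_vector) \<Rightarrow> 'v" where
  "vmean C x = (1 / real C) *\<^sub>R (\<Sum>c=1..C. x c)"

definition vspread :: "nat \<Rightarrow> (nat \<Rightarrow> 'v::real_normed_vector) \<Rightarrow> real" where
  "vspread C a = (1 / real C) * (\<Sum>c=1..C. (norm (a c - vmean C a))\<^sup>2)"

definition init_weight :: "real \<Rightarrow> nat \<Rightarrow> (nat \<Rightarrow> 'v::real_normed_vector) \<Rightarrow> real" where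
  "init_weight T C x = exp (- (\<Sum>c=1..C. (norm (x c - vmean C x))\<^sup>2 / (2 * T)))"

text \<open>The argument \<open>x\<close> maps a particle index \<open>i\<close> and a component index \<open>c\<close> to the starting point
  of component \<open>c\<close> of particle \<open>i\<close>; both indices start at 1.\<close>

definition CESS0 :: "real \<Rightarrow> nat \<Rightarrow> nat \<Rightarrow> (nat \<Rightarrow> nat \<Rightarrow> 'v::real_normed_vector) \<Rightarrow> real" where
  "CESS0 T C N x =
     (\<Sum>i=1..N. init_weight T C (x i))\<^sup>2 / (\<Sum>i=1..N. (init_weight T C (x i))\<^sup>2)"

end

theory Submission
  imports Defs
begin

text \<open>
  For every power \<open>n > 0\<close> the variables \<open>\<rho>\<^sub>0\<^sub>,\<^sub>i ^ n\<close> are independent, take values in the unit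
  interval and share one mean, so their averages converge almost surely: Hoeffding's inequality
  gives geometric tails, and Borel-Cantelli applies. Hence the limit is the squared mean of
  \<open>\<rho>\<^sub>0\<^sub>,\<^sub>1\<close> divided by the mean of its square. For these means, integrating
  \<open>exp (- k * (\<Sum>c. \<parallel>x c - t\<parallel>\<^sup>2))\<close> over an auxiliary centre \<open>t\<close> yields, up to a constant, the weight
  itself, and after exchanging the two integrals the components decouple into Gaussian integrals
  in one vector each. What remains is again an integral over \<open>t\<close> of the same shape, with the
  means \<open>a c\<close> in place of the \<open>x c\<close>.
\<close>

section \<open>Strong law of large numbers for bounded variables\<close>

text \<open>A common mean takes the place of identical distribution: Hoeffding's inequality sees
  only ranges and means, and the means of the weights are computed below in closed form.\<close>

lemma (in prob_space) strong_law_bounded: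
  fixes Y :: "nat \<Rightarrow> 'a \<Rightarrow> real"
  assumes indep: "indep_vars (\<lambda>_. borel) Y {1..}"
    and bounds: "\<And>i. i \<ge> 1 \<Longrightarrow> AE \<omega> in M. Y i \<omega> \<in> {l..u}" and "l < u"
    and mean: "\<And>i. i \<ge> 1 \<Longrightarrow> expectation (Y i) = \<mu>"
  shows "AE \<omega> in M. (\<lambda>n. (\<Sum>i=1..n. Y i \<omega>) / real n) \<longlonglongrightarrow> \<mu>"
proof -
  have [measurable]: "Y i \<in> borel_measurable M" if "i \<ge> 1" for i
    using indep that unfolding indep_vars_def by simp
  have dev: "AE \<omega> in M. \<forall>\<^sub>F n in sequentially. \<bar>(\<Sum>i=1..n. Y i \<omega>) - real n * \<mu>\<bar> < real n * \<epsilon>"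
    if "\<epsilon> > 0" for \<epsilon>
  proof -
    define A where "A n = {\<omega> \<in> space M. \<bar>(\<Sum>i=1..n. Y i \<omega>) - real n * \<mu>\<bar> \<ge> real n * \<epsilon>}" for n
    have A_sets: "A n \<in> sets M" for n
      unfolding A_def by measurable
    \<comment> \<open>The deviation is \<open>n * \<epsilon>\<close> and the squared ranges add up
      to \<open>n * (u - l)\<^sup>2\<close>, so Hoeffding's exponent is linear in \<open>n\<close>;
      \<open>q\<close> is the factor contributed by one variable.\<close>
    define q where "q = exp (- 2 * \<epsilon>\<^sup>2 / (u - l)\<^sup>2)"
    have "q < 1" "q > 0"
      using that \<open>l < u\<close> by (auto simp: q_def)
    have bound: "prob (A n) \<le> 2 * q ^ n" for n
    proof (cases "n = 0")
      case True
      \<comment> \<open>For \<open>n = 0\<close> the event \<open>A n\<close> is the whole space,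
        and the bound reads 2.\<close>
      then show ?thesis using prob_le_1[of "A n"] by (simp del: prob_le_1)
    next
      case False
      interpret H: Hoeffding_ineq M "{1..n}" Y "\<lambda>_. l" "\<lambda>_. u" "real n * \<mu>"
        by unfold_locales (auto simp: mean bounds[simplified] intro: indep_vars_subset[OF indep])
      have var: "(\<Sum>i=1..n. (u - l)\<^sup>2) = real n * (u - l)\<^sup>2" by simp
      have "prob (A n) \<le> 2 * exp (- 2 * (real n * \<epsilon>)\<^sup>2 / (real n * (u - l)\<^sup>2))"
        unfolding A_def var[symmetric]
        by (rule H.Hoeffding_ineq_abs_ge) (use \<open>\<epsilon> > 0\<close> \<open>l < u\<close> False in simp_all)
      also have "- 2 * (real n * \<epsilon>)\<^sup>2 / (real n * (u - l)\<^sup>2) = real n * (- 2 * \<epsilon>\<^sup>2 / (u - l)\<^sup>2)"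
        using False by (simp add: power_mult_distrib power2_eq_square[of "real n"])
      finally show ?thesis by (simp only: q_def exp_of_nat_mult)
    qed
    have "summable (\<lambda>n. prob (A n))"
    proof (rule summable_comparison_test)
      show "\<exists>N. \<forall>n\<ge>N. norm (prob (A n)) \<le> 2 * q ^ n" using bound by auto
      show "summable (\<lambda>n. 2 * q ^ n)"
        using \<open>q < 1\<close> \<open>q > 0\<close> by (intro summable_mult summable_geometric) auto
    qed
    then have "AE \<omega> in M. \<forall>\<^sub>F n in sequentially. \<omega> \<in> space M - A n"
      by (intro borel_cantelli_AE1 A_sets) (auto simp: emeasure_eq_measure)
    then show ?thesis
      by (rule AE_mp) (intro AE_I2 impI, erule eventually_mono, simp add: A_def not_le)
  qed
  \<comment> \<open>The null set in \<open>dev\<close> depends on \<epsilon>. Passing to the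
    countable family \<open>1 / Suc k\<close> gives one null set for all tolerances.\<close>
  have "AE \<omega> in M. \<forall>k. \<forall>\<^sub>F n in sequentially.
      \<bar>(\<Sum>i=1..n. Y i \<omega>) - real n * \<mu>\<bar> < real n * (1 / real (Suc k))"
    unfolding AE_all_countable by (intro allI dev) simp
  then show ?thesis
  proof (rule AE_mp, intro AE_I2 impI)
    fix \<omega> assume *: "\<forall>k. \<forall>\<^sub>F n in sequentially.
      \<bar>(\<Sum>i=1..n. Y i \<omega>) - real n * \<mu>\<bar> < real n * (1 / real (Suc k))"
    show "(\<lambda>n. (\<Sum>i=1..n. Y i \<omega>) / real n) \<longlonglongrightarrow> \<mu>"
    proof (rule tendstoI)
      fix e :: real assume "e > 0"
      then obtain k where k: "1 / real (Suc k) < e" using nat_approx_posE by blast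
      show "\<forall>\<^sub>F n in sequentially. dist ((\<Sum>i=1..n. Y i \<omega>) / real n) \<mu> < e"
        using *[rule_format, of k] eventually_gt_at_top[of 0]
      proof eventually_elim
        case (elim n)
        have "(\<Sum>i=1..n. Y i \<omega>) / real n - \<mu> = ((\<Sum>i=1..n. Y i \<omega>) - real n * \<mu>) / real n"
          using elim(2) by (simp add: diff_divide_distrib)
        then have "dist ((\<Sum>i=1..n. Y i \<omega>) / real n) \<mu> = \<bar>(\<Sum>i=1..n. Y i \<omega>) - real n * \<mu>\<bar> / real n"
          unfolding dist_real_def by simp
        also have "\<dots> < 1 / real (Suc k)"
          using elim by (simp only: pos_divide_less_eq of_nat_0_less_iff mult.commute)
        finally show ?case using k by simp
      qed
    qed
  qed
qed

section \<open>Gaussian integrals and completing the square\<close>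

text \<open>Working with nonnegative integrals here and below lets factors be split off and
  integrals exchanged on measurability alone.\<close>

lemma nn_integral_gaussian_real:
  fixes a k :: real
  assumes "k > 0"
  shows "(\<integral>\<^sup>+x. ennreal (exp (- k * (x - a)\<^sup>2)) \<partial>lborel) = ennreal (sqrt (pi / k))"
proof -
  \<comment> \<open>The standard deviation with \<open>1 / (2 * s\<^sup>2) = k\<close>; the
    normalising constant is then \<open>sqrt (pi / k)\<close>.\<close>
  define s where "s = 1 / sqrt (2 * k)"
  have s: "s > 0" "s\<^sup>2 = 1 / (2 * k)"
    using assms by (auto simp: s_def power_divide)
  have "(\<integral>\<^sup>+x. ennreal (exp (- k * (x - a)\<^sup>2)) \<partial>lborel)
      = (\<integral>\<^sup>+x. ennreal (sqrt (pi / k)) * ennreal (normal_density a s x) \<partial>lborel)"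
    using assms by (intro nn_integral_cong)
      (simp add: normal_density_def s ennreal_mult[symmetric])
  also have "\<dots> = ennreal (sqrt (pi / k)) * ennreal (\<integral>x. normal_density a s x \<partial>lborel)"
    using s by (simp add: nn_integral_cmult nn_integral_eq_integral del: integral_normal_density)
  finally show ?thesis using s by simp
qed

text \<open>The squared norm is a sum over coordinates, so the integrand is a product of
  one-dimensional Gaussians.\<close>

lemma nn_integral_gaussian:
  fixes a :: "'a::euclidean_space" and k :: real
  assumes "k > 0"
  shows "(\<integral>\<^sup>+x. ennreal (exp (- k * (norm (x - a))\<^sup>2)) \<partial>lborel)
    = ennreal ((pi / k) powr (real DIM('a) / 2))"
proof -
  have nrm: "(norm (x - a))\<^sup>2 = (\<Sum>b\<in>Basis. (x \<bullet> b - a \<bullet> b)\<^sup>2)" for x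
    unfolding power2_norm_eq_inner euclidean_inner[of "x - a" "x - a"]
    by (simp add: inner_diff_left power2_eq_square)
  have "(\<integral>\<^sup>+x. ennreal (exp (- k * (norm (x - a))\<^sup>2)) \<partial>lborel)
      = (\<integral>\<^sup>+x. (\<Prod>b\<in>Basis. ennreal (exp (- k * (x \<bullet> b - a \<bullet> b)\<^sup>2))) \<partial>lborel)"
    by (intro nn_integral_cong)
      (simp add: nrm prod_ennreal exp_sum[symmetric] sum_distrib_left sum_negf)
  also have "\<dots> = (\<Prod>b\<in>(Basis :: 'a set). \<integral>\<^sup>+x. ennreal (exp (- k * (x - a \<bullet> b)\<^sup>2)) \<partial>lborel)"
    by (rule nn_integral_lborel_prod) auto
  also have "\<dots> = ennreal (sqrt (pi / k) ^ DIM('a))"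
    using assms by (simp only: nn_integral_gaussian_real) (simp add: ennreal_power)
  also have "sqrt (pi / k) ^ DIM('a) = (pi / k) powr (real DIM('a) / 2)"
    using assms by (simp add: powr_half_sqrt[symmetric] powr_power)
  finally show ?thesis .
qed

text \<open>Completing the square in \<open>x\<close> around the weighted centre of \<open>y\<close>
  and \<open>z\<close>. It merges a normal density and a Gaussian kernel into one Gaussian in
  \<open>x\<close>, times a factor free of \<open>x\<close>.\<close>

lemma weighted_sum_sq_dist:
  fixes x y z :: "'a::real_inner"
  assumes "p > 0" "q > 0"
  shows "p * (norm (x - y))\<^sup>2 + q * (norm (x - z))\<^sup>2
    = (p + q) * (norm (x - (1 / (p + q)) *\<^sub>R (p *\<^sub>R y + q *\<^sub>R z)))\<^sup>2
      + p * q / (p + q) * (norm (y - z))\<^sup>2"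
proof -
  define s where "s = p + q"
  have "s > 0" using assms by (simp add: s_def)
  define A B where "A = x - y" and "B = x - z"
  have "x = (1 / s) *\<^sub>R (p *\<^sub>R x + q *\<^sub>R x)"
    using \<open>s > 0\<close> by (simp add: s_def flip: scaleR_add_left)
  moreover have "(1 / s) *\<^sub>R (p *\<^sub>R A + q *\<^sub>R B)
      = (1 / s) *\<^sub>R (p *\<^sub>R x + q *\<^sub>R x) - (1 / s) *\<^sub>R (p *\<^sub>R y + q *\<^sub>R z)"
    by (simp add: A_def B_def scaleR_diff_right scaleR_add_right)
  ultimately have "x - (1 / s) *\<^sub>R (p *\<^sub>R y + q *\<^sub>R z) = (1 / s) *\<^sub>R (p *\<^sub>R A + q *\<^sub>R B)"
    by metis
  then have centre: "(norm (x - (1 / s) *\<^sub>R (p *\<^sub>R y + q *\<^sub>R z)))\<^sup>2 = (norm (p *\<^sub>R A + q *\<^sub>R B))\<^sup>2 / s\<^sup>2"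
    by (simp add: power_divide)
  \<comment> \<open>Multiplying by \<open>s = p + q\<close> clears the denominators; what remains is
    bilinear expansion.\<close>
  have "s * (p * (norm A)\<^sup>2 + q * (norm B)\<^sup>2) = (norm (p *\<^sub>R A + q *\<^sub>R B))\<^sup>2 + p * q * (norm (B - A))\<^sup>2"
    unfolding power2_norm_eq_inner s_def by (simp add: inner_simps inner_commute algebra_simps)
  moreover have yz: "y - z = B - A" by (simp add: A_def B_def)
  ultimately show ?thesis
    using \<open>s > 0\<close> unfolding s_def[symmetric] centre yz
    unfolding A_def[symmetric] B_def[symmetric] by (simp add: field_simps power2_eq_square)
qed

text \<open>The parallel axis identity: the cross term vanishes because deviations from the mean sum
  to zero.\<close>

lemma sum_sq_dist_vmean:
  fixes x :: "nat \<Rightarrow> 'a::real_inner"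
  assumes "C > 0"
  shows "(\<Sum>c=1..C. (norm (x c - t))\<^sup>2)
    = (\<Sum>c=1..C. (norm (x c - vmean C x))\<^sup>2) + real C * (norm (t - vmean C x))\<^sup>2"
proof -
  define w where "w = vmean C x"
  have w: "(\<Sum>c=1..C. x c - w) = 0"
    using assms by (simp add: w_def vmean_def sum_subtractf sum_constant_scaleR del: sum_constant)
  have "(norm (x c - t))\<^sup>2 = (norm (x c - w))\<^sup>2 + (norm (t - w))\<^sup>2 - 2 * ((x c - w) \<bullet> (t - w))" for c
    unfolding power2_norm_eq_inner by (simp add: inner_simps inner_commute)
  then have "(\<Sum>c=1..C. (norm (x c - t))\<^sup>2)
      = (\<Sum>c=1..C. (norm (x c - w))\<^sup>2) + real C * (norm (t - w))\<^sup>2 - 2 * (\<Sum>c=1..C. (x c - w) \<bullet> (t - w))"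
    by (simp only: sum.distrib sum_subtractf sum_distrib_left[symmetric]) simp
  then show ?thesis
    by (simp only: inner_sum_left[symmetric] w w_def[symmetric]) simp
qed

text \<open>By the parallel axis identity the integrand is, in \<open>t\<close>, a Gaussian of rate
  \<open>k * C\<close> around the mean. The mean couples the components on the right, while the left
  side has one factor for each; the identity serves once for the random points and once for their
  means \<open>a c\<close>.\<close>

lemma nn_integral_prod_gaussian:
  fixes x :: "nat \<Rightarrow> 'a::euclidean_space"
  assumes "k > 0" "C > 0"
  shows "(\<integral>\<^sup>+t. (\<Prod>c=1..C. ennreal (exp (- k * (norm (x c - t))\<^sup>2))) \<partial>lborel)
    = ennreal ((pi / (k * real C)) powr (real DIM('a) / 2))
      * ennreal (exp (- k * (\<Sum>c=1..C. (norm (x c - vmean C x))\<^sup>2)))"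
proof -
  have "(\<integral>\<^sup>+t. (\<Prod>c=1..C. ennreal (exp (- k * (norm (x c - t))\<^sup>2))) \<partial>lborel)
      = (\<integral>\<^sup>+t. ennreal (exp (- (k * real C) * (norm (t - vmean C x))\<^sup>2))
        * ennreal (exp (- k * (\<Sum>c=1..C. (norm (x c - vmean C x))\<^sup>2))) \<partial>lborel)"
  proof (rule nn_integral_cong)
    fix t :: 'a
    have "(\<Prod>c=1..C. ennreal (exp (- k * (norm (x c - t))\<^sup>2)))
        = ennreal (exp (- k * (\<Sum>c=1..C. (norm (x c - t))\<^sup>2)))"
      by (simp add: prod_ennreal exp_sum[symmetric] sum_distrib_left sum_negf)
    also have "\<dots> = ennreal (exp (- (k * real C) * (norm (t - vmean C x))\<^sup>2))
        * ennreal (exp (- k * (\<Sum>c=1..C. (norm (x c - vmean C x))\<^sup>2)))"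
      unfolding sum_sq_dist_vmean[OF assms(2), of x t]
      by (simp add: ennreal_mult[symmetric] exp_add[symmetric] algebra_simps)
    finally show "(\<Prod>c=1..C. ennreal (exp (- k * (norm (x c - t))\<^sup>2))) = \<dots>" .
  qed
  also have "\<dots> = ennreal ((pi / (k * real C)) powr (real DIM('a) / 2))
      * ennreal (exp (- k * (\<Sum>c=1..C. (norm (x c - vmean C x))\<^sup>2)))"
    using assms by (subst nn_integral_multc)
      (simp, simp only: nn_integral_gaussian mult_pos_pos of_nat_0_less_iff)
  finally show ?thesis .
qed

text \<open>Variances add under convolution: a kernel of rate \<open>k\<close> has variance
  \<open>1 / (2 * k)\<close>, and adding \<open>v\<close> gives the rate
  \<open>k / (1 + 2 * k * v)\<close>.\<close>

lemma nn_integral_iso_normal_gaussian: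
  fixes a t :: "real ^ 'd"
  assumes "v > 0" "k > 0"
  shows "(\<integral>\<^sup>+x. ennreal (iso_normal_density a v x) * ennreal (exp (- k * (norm (x - t))\<^sup>2)) \<partial>lborel)
    = ennreal ((1 + 2 * k * v) powr (- real CARD('d) / 2))
      * ennreal (exp (- (k / (1 + 2 * k * v)) * (norm (a - t))\<^sup>2))"
proof -
  \<comment> \<open>\<open>h\<close> is the rate of the density, \<mu> the centre from
    \<open>weighted_sum_sq_dist\<close>, and \<open>E\<close> the remaining factor, constant in
    \<open>x\<close>.\<close>
  define h where "h = 1 / (2 * v)"
  define K where "K = (2 * pi * v) powr (- real CARD('d) / 2)"
  define \<mu> where "\<mu> = (1 / (h + k)) *\<^sub>R (h *\<^sub>R a + k *\<^sub>R t)"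
  define E where "E = exp (- (k / (1 + 2 * k * v)) * (norm (a - t))\<^sup>2)"
  have "h > 0" using assms by (simp add: h_def)
  have hk: "h * k / (h + k) = k / (1 + 2 * k * v)"
    using assms by (simp add: h_def field_simps)
  have "iso_normal_density a v x * exp (- k * (norm (x - t))\<^sup>2)
      = K * E * exp (- (h + k) * (norm (x - \<mu>))\<^sup>2)" for x
  proof -
    have "iso_normal_density a v x * exp (- k * (norm (x - t))\<^sup>2)
        = K * exp (- (h * (norm (x - a))\<^sup>2 + k * (norm (x - t))\<^sup>2))"
      by (simp add: iso_normal_density_def K_def h_def exp_add[symmetric])
    also have "\<dots> = K * E * exp (- (h + k) * (norm (x - \<mu>))\<^sup>2)"
      unfolding weighted_sum_sq_dist[OF \<open>h > 0\<close> \<open>k > 0\<close>] hk E_def \<mu>_def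
      by (simp add: exp_add[symmetric] algebra_simps)
    finally show ?thesis .
  qed
  then have "(\<integral>\<^sup>+x. ennreal (iso_normal_density a v x) * ennreal (exp (- k * (norm (x - t))\<^sup>2)) \<partial>lborel)
      = (\<integral>\<^sup>+x. ennreal (K * E) * ennreal (exp (- (h + k) * (norm (x - \<mu>))\<^sup>2)) \<partial>lborel)"
    by (intro nn_integral_cong) (simp add: ennreal_mult'' [symmetric] K_def E_def)
  also have "\<dots> = ennreal (K * E) * ennreal ((pi / (h + k)) powr (real CARD('d) / 2))"
    using \<open>h > 0\<close> \<open>k > 0\<close> by (subst nn_integral_cmult) (simp, subst nn_integral_gaussian, simp_all)
  also have "\<dots> = ennreal (K * (pi / (h + k)) powr (real CARD('d) / 2)) * ennreal E"
    by (simp add: ennreal_mult[symmetric] K_def E_def mult_ac)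
  also have "K * (pi / (h + k)) powr (real CARD('d) / 2) = (1 + 2 * k * v) powr (- real CARD('d) / 2)"
  proof -
    have "pi / (h + k) = (2 * pi * v) / (1 + 2 * k * v)"
      using assms by (simp add: h_def field_simps)
    then show ?thesis
      using assms by (simp add: K_def powr_divide powr_minus field_simps)
  qed
  finally show ?thesis unfolding E_def .
qed

section \<open>Moments of the initial weight\<close>

text \<open>For a fixed centre \<open>t\<close> independence turns the expectation of the product
  into a product of Gaussian convolutions.\<close>

lemma (in prob_space) nn_integral_prod_iso_normal_gaussian:
  fixes X :: "nat \<Rightarrow> 'a \<Rightarrow> real ^ 'd" and a :: "nat \<Rightarrow> real ^ 'd"
  assumes "v > 0" "k > 0"
    and distr: "\<And>c. c \<in> {1..C} \<Longrightarrow>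
      distributed M lborel (X c) (\<lambda>x. ennreal (iso_normal_density (a c) v x))"
    and indep: "indep_vars (\<lambda>_. borel) X {1..C}"
  shows "(\<integral>\<^sup>+\<omega>. (\<Prod>c=1..C. ennreal (exp (- k * (norm (X c \<omega> - t))\<^sup>2))) \<partial>M)
    = ennreal (((1 + 2 * k * v) powr (- real CARD('d) / 2)) ^ C)
      * (\<Prod>c=1..C. ennreal (exp (- (k / (1 + 2 * k * v)) * (norm (a c - t))\<^sup>2)))"
proof -
  have "(\<integral>\<^sup>+\<omega>. (\<Prod>c=1..C. ennreal (exp (- k * (norm (X c \<omega> - t))\<^sup>2))) \<partial>M)
      = (\<Prod>c=1..C. \<integral>\<^sup>+\<omega>. ennreal (exp (- k * (norm (X c \<omega> - t))\<^sup>2)) \<partial>M)"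
    by (intro indep_vars_nn_integral indep_vars_compose2[OF indep]) auto
  also have "\<dots> = (\<Prod>c=1..C. ennreal ((1 + 2 * k * v) powr (- real CARD('d) / 2))
      * ennreal (exp (- (k / (1 + 2 * k * v)) * (norm (a c - t))\<^sup>2)))"
    by (intro prod.cong refl, subst nn_integral_iso_normal_gaussian[OF assms(1,2), symmetric],
        subst distributed_nn_integral[OF distr]) auto
  finally show ?thesis
    by (simp only: prod.distrib prod_constant card_atLeastAtMost ennreal_power powr_ge_zero) simp
qed

text \<open>With \<open>u = 1 + 2 * k * v\<close> and \<open>d\<close> the dimension, each of the
  \<open>C\<close> components contributes \<open>u powr (- d / 2)\<close>. The last integral over
  \<open>t\<close> has rate \<open>k / u\<close> instead of \<open>k\<close> and gives back one
  factor \<open>u powr (d / 2)\<close>, whence the exponent with \<open>C - 1\<close>.\<close>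

lemma (in prob_space) expectation_exp_sum_sq_dist_vmean:
  fixes X :: "nat \<Rightarrow> 'a \<Rightarrow> real ^ 'd" and a :: "nat \<Rightarrow> real ^ 'd"
  assumes "v > 0" "k > 0" "C > 0"
    and distr: "\<And>c. c \<in> {1..C} \<Longrightarrow>
      distributed M lborel (X c) (\<lambda>x. ennreal (iso_normal_density (a c) v x))"
    and indep: "indep_vars (\<lambda>_. borel) X {1..C}"
  shows "expectation (\<lambda>\<omega>. exp (- k * (\<Sum>c=1..C. (norm (X c \<omega> - vmean C (\<lambda>c. X c \<omega>)))\<^sup>2)))
    = (1 + 2 * k * v) powr (- ((real C - 1) * real CARD('d) / 2))
      * exp (- (k / (1 + 2 * k * v)) * (real C * vspread C a))"
proof -
  define u where "u = 1 + 2 * k * v"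
  define d where "d = real CARD('d)"
  define F where "F \<omega> = exp (- k * (\<Sum>c=1..C. (norm (X c \<omega> - vmean C (\<lambda>c. X c \<omega>)))\<^sup>2))" for \<omega>
  define G where "G = exp (- (k / u) * (\<Sum>c=1..C. (norm (a c - vmean C a))\<^sup>2))"
  have "u > 0" using assms by (simp add: u_def pos_add_strict)
  have Xm [measurable]: "X c \<in> borel_measurable M" if "c \<in> {1..C}" for c
    using distributed_measurable[OF distr[OF that]] by simp
  have [measurable]: "F \<in> borel_measurable M"
    unfolding F_def vmean_def by measurable
  interpret pair_sigma_finite M "lborel :: (real ^ 'd) measure" ..
  \<comment> \<open>The prefactor is the normalisation of the auxiliary centre; it reappears on the
    right and, being positive and finite, is cancelled at the end.\<close>
  have "ennreal ((pi / (k * real C)) powr (d / 2)) * (\<integral>\<^sup>+\<omega>. ennreal (F \<omega>) \<partial>M)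
      = (\<integral>\<^sup>+\<omega>. (\<integral>\<^sup>+t. (\<Prod>c=1..C. ennreal (exp (- k * (norm (X c \<omega> - t))\<^sup>2))) \<partial>lborel) \<partial>M)"
    using assms
    by (subst nn_integral_cmult[symmetric], measurable)
      (simp only: nn_integral_prod_gaussian F_def d_def, simp)
  also have "\<dots> = (\<integral>\<^sup>+t. (\<integral>\<^sup>+\<omega>. (\<Prod>c=1..C. ennreal (exp (- k * (norm (X c \<omega> - t))\<^sup>2))) \<partial>M) \<partial>lborel)"
    by (rule Fubini'[symmetric]) measurable
  also have "\<dots> = (\<integral>\<^sup>+t. ennreal ((u powr (- d / 2)) ^ C)
      * (\<Prod>c=1..C. ennreal (exp (- (k / u) * (norm (a c - t))\<^sup>2))) \<partial>lborel)"
    using nn_integral_prod_iso_normal_gaussian[OF assms(1,2) distr indep]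
    by (simp only: u_def d_def)
  also have "\<dots> = ennreal ((u powr (- d / 2)) ^ C)
      * (ennreal ((pi / (k / u * real C)) powr (d / 2)) * ennreal G)"
    using \<open>k > 0\<close> \<open>C > 0\<close> \<open>u > 0\<close> unfolding G_def d_def
    by (subst nn_integral_cmult, measurable) (subst nn_integral_prod_gaussian, simp_all)
  also have "pi / (k / u * real C) = u * (pi / (k * real C))"
    using \<open>u > 0\<close> by simp
  also have "(u * (pi / (k * real C))) powr (d / 2) = u powr (d / 2) * (pi / (k * real C)) powr (d / 2)"
    using assms \<open>u > 0\<close> by (intro powr_mult)
  also have "ennreal ((u powr (- d / 2)) ^ C) * (ennreal \<dots> * ennreal G)
      = ennreal ((pi / (k * real C)) powr (d / 2)) * ennreal (u powr (- ((real C - 1) * d / 2)) * G)"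
  proof -
    have "(u powr (- d / 2)) ^ C * u powr (d / 2) = u powr (- ((real C - 1) * d / 2))"
      using \<open>u > 0\<close> by (simp add: powr_power powr_add[symmetric] left_diff_distrib diff_divide_distrib)
    moreover have "ennreal p * (ennreal (r * q) * ennreal g) = ennreal q * ennreal (p * r * g)"
      if "p \<ge> 0" "q \<ge> 0" "r \<ge> 0" "g \<ge> 0" for p q r g :: real
      using that by (simp add: ennreal_mult mult_ac)
    ultimately show ?thesis
      by (simp add: G_def)
  qed
  finally have "(\<integral>\<^sup>+\<omega>. ennreal (F \<omega>) \<partial>M) = ennreal (u powr (- ((real C - 1) * d / 2)) * G)"
    using assms by (subst (asm) ennreal_mult_cancel_left) (auto simp: ennreal_eq_0_iff)
  then have "expectation F = u powr (- ((real C - 1) * d / 2)) * G"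
    by (subst integral_eq_nn_integral) (simp_all add: F_def G_def)
  moreover have "(\<Sum>c=1..C. (norm (a c - vmean C a))\<^sup>2) = real C * vspread C a"
    using assms by (simp add: vspread_def)
  ultimately show ?thesis
    by (simp only: F_def[abs_def] G_def u_def d_def)
qed

section \<open>Powers of the weight and the closed form of the limit\<close>

text \<open>Raising to a power only changes the rate to \<open>n / (2 * T)\<close>, so one formula
  gives both the mean and the mean square.\<close>

lemma init_weight_power:
  "init_weight T C x ^ n
    = exp (- (real n / (2 * T)) * (\<Sum>c=1..C. (norm (x c - vmean C x))\<^sup>2))"
  unfolding init_weight_def
  by (simp add: exp_of_nat_mult[symmetric] sum_divide_distrib[symmetric])

text \<open>Independence of the particles is stated for tuples restricted to \<open>{1..C}\<close>,
  as points of a product space; this removes the restriction inside the weight.\<close>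

lemma init_weight_restrict: "init_weight T C (restrict x {1..C}) = init_weight T C x"
  unfolding init_weight_def vmean_def by simp

lemma measurable_init_weight [measurable]:
  "init_weight T C \<in> borel_measurable
    (Pi\<^sub>M {1..C} (\<lambda>_. borel :: 'v::{real_normed_vector, second_countable_topology} measure))"
  unfolding init_weight_def vmean_def by measurable

text \<open>The exponents combine through \<open>s / (1 + u) - s / (1 + 2 * u)\<close>, and the
  bases through \<open>(1 + u)\<^sup>2 = (1 + 2 * u) + u\<^sup>2\<close>.\<close>

lemma squared_mean_over_mean_square:
  fixes u s e :: real
  assumes "u > 0"
  shows "((1 + u) powr - e * exp (- (s / (2 * (1 + u)))))\<^sup>2
      / ((1 + 2 * u) powr - e * exp (- (s / (1 + 2 * u))))
    = exp (- (s * u / ((1 + u) * (1 + 2 * u)))) * (1 + u\<^sup>2 / (1 + 2 * u)) powr - e"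
proof -
  have regroup: "(p * q)\<^sup>2 / (p' * q') = (q\<^sup>2 / q') * (p\<^sup>2 / p')" for p q p' q' :: real
    by (simp add: power_mult_distrib mult_ac)
  have "- (s * u / ((1 + u) * (1 + 2 * u))) = 2 * - (s / (2 * (1 + u))) - - (s / (1 + 2 * u))"
  proof -
    have diff: "s / (1 + u) - s / (1 + 2 * u) = s * u / ((1 + u) * (1 + 2 * u))"
      using assms by (simp add: field_simps)
    have double: "2 * (s / (2 * (1 + u))) = s / (1 + u)"
      using assms by (simp add: field_simps)
    show ?thesis
      by (simp only: diff[symmetric] double mult_minus_right minus_diff_eq
          diff_minus_eq_add uminus_add_conv_diff)
  qed
  then have "(exp (- (s / (2 * (1 + u)))))\<^sup>2 / exp (- (s / (1 + 2 * u)))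
      = exp (- (s * u / ((1 + u) * (1 + 2 * u))))"
    by (simp only: exp_diff exp_double)
  moreover have "((1 + u) powr - e)\<^sup>2 / (1 + 2 * u) powr - e = (1 + u\<^sup>2 / (1 + 2 * u)) powr - e"
  proof -
    have "1 + u\<^sup>2 / (1 + 2 * u) = (1 + u)\<^sup>2 / (1 + 2 * u)"
      using assms by (simp add: field_simps power2_eq_square)
    moreover have "((1 + u) powr - e)\<^sup>2 = ((1 + u)\<^sup>2) powr - e"
      using assms by (simp add: power2_eq_square powr_mult)
    ultimately show ?thesis
      using assms by (simp only: powr_divide)
  qed
  ultimately show ?thesis
    by (simp only: regroup)
qed

section \<open>Convergence of the normalised effective sample size\<close>

theorem theorem4:
  fixes M :: "'w measure"
    and X :: "nat \<Rightarrow> nat \<Rightarrow> 'w \<Rightarrow> real ^ 'd"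
    and a :: "nat \<Rightarrow> real ^ 'd"
    and b T m :: real and C :: nat
  assumes "prob_space M"
    and "b > 0" and "T > 0" and "C > 1" and "m > real C"
    and distr: "\<And>i c. i \<ge> 1 \<Longrightarrow> c \<in> {1..C} \<Longrightarrow>
      distributed M lborel (X i c) (\<lambda>x. ennreal (iso_normal_density (a c) (real C * b / m) x))"
    and indep_components: "\<And>i. i \<ge> 1 \<Longrightarrow>
      prob_space.indep_vars M (\<lambda>_. borel) (X i) {1..C}"
    and indep_particles:
      "prob_space.indep_vars M (\<lambda>_. Pi\<^sub>M {1..C} (\<lambda>_. borel))
         (\<lambda>i \<omega>. \<lambda>c\<in>{1..C}. X i c \<omega>) {1..}"
  shows "AE \<omega> in M.
    (\<lambda>N. CESS0 T C N (\<lambda>i c. X i c \<omega>) / real N) \<longlonglongrightarrow>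
      exp (- ((vspread C a * b / m) /
               ((T / real C + b / m) * (T / real C + 2 * b / m)))) *
      (1 + (real C * b / (T * m))\<^sup>2 / (1 + 2 * real C * b / (T * m)))
        powr (- ((real C - 1) * real CARD('d) / 2))"
proof -
  interpret prob_space M by fact
  define v where "v = real C * b / m"
  \<comment> \<open>The expectation at rate \<open>k\<close> for the variance \<open>v\<close>; the
    moments of order 1 and 2 are its values at \<open>1 / (2 * T)\<close> and
    \<open>1 / T\<close>.\<close>
  define L where "L k = (1 + 2 * k * v) powr (- ((real C - 1) * real CARD('d) / 2))
      * exp (- (k / (1 + 2 * k * v)) * (real C * vspread C a))" for k
  have "m > 0" using \<open>m > real C\<close> by linarith
  then have "v > 0" using \<open>b > 0\<close> \<open>C > 1\<close> by (simp add: v_def)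
  have power_mean: "AE \<omega> in M. (\<lambda>N. (\<Sum>i=1..N. init_weight T C (\<lambda>c. X i c \<omega>) ^ n) / real N)
      \<longlonglongrightarrow> L (real n / (2 * T))" if "n > 0" for n
  proof (rule strong_law_bounded)
    have "indep_vars (\<lambda>_. borel)
        (\<lambda>i \<omega>. init_weight T C (\<lambda>c\<in>{1..C}. X i c \<omega>) ^ n) {1..}"
      by (rule indep_vars_compose2[OF indep_particles]) measurable
    then show "indep_vars (\<lambda>_. borel) (\<lambda>i \<omega>. init_weight T C (\<lambda>c. X i c \<omega>) ^ n) {1..}"
      by (simp only: init_weight_restrict)
    show "AE \<omega> in M. init_weight T C (\<lambda>c. X i c \<omega>) ^ n \<in> {0..1}" for i
      using \<open>T > 0\<close> by (intro AE_I2) (simp add: init_weight_def power_le_one sum_nonneg)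
    show "expectation (\<lambda>\<omega>. init_weight T C (\<lambda>c. X i c \<omega>) ^ n) = L (real n / (2 * T))" if "i \<ge> 1" for i
      unfolding init_weight_power L_def
      by (rule expectation_exp_sum_sq_dist_vmean
          [OF \<open>v > 0\<close> _ _ distr[folded v_def, OF that] indep_components[OF that]])
        (use \<open>T > 0\<close> \<open>C > 1\<close> \<open>n > 0\<close> in simp_all)
  qed simp
  have "L (1 / (2 * T)) ^ 2 / L (1 / T) = exp (- ((vspread C a * b / m) /
        ((T / real C + b / m) * (T / real C + 2 * b / m)))) *
      (1 + (real C * b / (T * m))\<^sup>2 / (1 + 2 * real C * b / (T * m)))
        powr (- ((real C - 1) * real CARD('d) / 2))"
  proof -
    \<comment> \<open>Here \<open>u\<close> is \<open>v / T\<close>. The factor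
      \<open>w = T / C\<close> scales the two denominators to \<open>1 + u\<close> and
      \<open>1 + 2 * u\<close>, and \<open>w\<^sup>2\<close> cancels against the numerator.\<close>
    define u where "u = real C * b / (T * m)"
    define s where "s = real C * vspread C a / T"
    define w where "w = T / real C"
    define e where "e = (real C - 1) * real CARD('d) / 2"
    have pos: "u > 0" "w > 0"
      using \<open>b > 0\<close> \<open>T > 0\<close> \<open>C > 1\<close> \<open>m > 0\<close> by (simp_all add: u_def w_def)
    have k: "2 * (1 / (2 * T)) * v = u" "2 * (1 / T) * v = 2 * u"
      using \<open>T > 0\<close> by (simp_all add: u_def v_def)
    have "L (1 / (2 * T)) = (1 + u) powr - e * exp (- (s / (2 * (1 + u))))"
      "L (1 / T) = (1 + 2 * u) powr - e * exp (- (s / (1 + 2 * u)))"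
      unfolding L_def k e_def[symmetric] by (simp_all add: s_def)
    moreover have "vspread C a * b / m = s * u * w\<^sup>2"
      "T / real C + b / m = w * (1 + u)" "T / real C + 2 * b / m = w * (1 + 2 * u)"
      using \<open>T > 0\<close> \<open>C > 1\<close> \<open>m > 0\<close>
      by (simp_all add: s_def u_def w_def field_simps power2_eq_square)
    then have "vspread C a * b / m / ((T / real C + b / m) * (T / real C + 2 * b / m))
        = s * u / ((1 + u) * (1 + 2 * u))"
      using pos by (simp add: power2_eq_square)
    moreover have "2 * real C * b / (T * m) = 2 * u" by (simp add: u_def)
    ultimately show ?thesis
      using squared_mean_over_mean_square[OF \<open>u > 0\<close>, of e s]
      by (simp only: u_def[symmetric] e_def[symmetric])
  qed
  moreover have "AE \<omega> in M. (\<lambda>N. CESS0 T C N (\<lambda>i c. X i c \<omega>) / real N)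
      \<longlonglongrightarrow> L (1 / (2 * T)) ^ 2 / L (1 / T)"
    \<comment> \<open>The instances for the powers 1 and 2; \<open>num.Bit0 num.One\<close> is the
      numeral 2.\<close>
    using power_mean[OF zero_less_one] power_mean[OF zero_less_numeral, of "num.Bit0 num.One"]
  proof eventually_elim
    case (elim \<omega>)
    \<comment> \<open>Dividing both sums by \<open>N\<close> leaves a single \<open>1 / N\<close>.
      As division by zero yields zero, this also holds at \<open>N = 0\<close>, so the two sequences
      agree everywhere.\<close>
    have ratio: "(p / n)\<^sup>2 / (q / n) = p\<^sup>2 / q / n" for p q n :: real
      by (cases "n = 0") (simp_all add: power2_eq_square)
    have "L (1 / T) \<noteq> 0"
      using \<open>T > 0\<close> \<open>v > 0\<close> by (simp add: L_def add_nonneg_eq_0_iff)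
    then have "(\<lambda>N. ((\<Sum>i=1..N. init_weight T C (\<lambda>c. X i c \<omega>)) / real N)\<^sup>2
        / ((\<Sum>i=1..N. (init_weight T C (\<lambda>c. X i c \<omega>))\<^sup>2) / real N))
        \<longlonglongrightarrow> L (1 / (2 * T)) ^ 2 / L (1 / T)"
      using elim by (intro tendsto_intros) simp_all
    then show ?case
      unfolding CESS0_def ratio .
  qed
  ultimately show ?thesis by simp
qed

end
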